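(* Let $n,k,\ell$ be integers with $n\geq k\geq\ell\geq 2$ such that no prime less than $k$ divides $n$. Then $G(k,n)$ has an $\ell$-decomposition.
   Context: $[n]:=\{1,2,\dots,n\}$. $G(k,n)$ is the complete $k$-partite graph with $n$ vertices in each colour class: its vertex set is $[k]\times[n]$, and $(c,u)$ is adjacent to $(d,v)$ if and only if $c\neq d$. $K_m$ is the complete graph on $m$ vertices. An $\ell$-decomposition of $G(k,n)$ is a set $X$ of copies of $K_k$ in $G(k,n)$ (i.e. subgraphs isomorphic to $K_k$) such that each copy of $K_\ell$ in $G(k,n)$ is a subgraph of exactly one copy of $K_k$ in $X$. *)

theory Defs
  imports "Graph_Theory.Graph_Theory" "HOL-Computational_Algebra.Primes"
begin

text \<open>
  A simple graph is a symmetric loop-free digraph without parallel arcs, an edge between \<open>u\<close> and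
  \<open>v\<close> being the two arcs \<open>(u, v)\<close> and \<open>(v, u)\<close>.
\<close>

definition complete_graph :: "nat \<Rightarrow> nat pair_pre_digraph" where
  "complete_graph m = \<lparr>pverts = {1..m}, parcs = {(u, v). u \<in> {1..m} \<and> v \<in> {1..m} \<and> u \<noteq> v}\<rparr>"

definition complete_multipartite :: "nat \<Rightarrow> nat \<Rightarrow> (nat \<times> nat) pair_pre_digraph" where
  "complete_multipartite k n =
     \<lparr>pverts = {1..k} \<times> {1..n},
      parcs = {((c, u), (d, v)). c \<in> {1..k} \<and> d \<in> {1..k} \<and> u \<in> {1..n} \<and> v \<in> {1..n} \<and> c \<noteq> d}\<rparr>"

definition copies :: "'a pair_pre_digraph \<Rightarrow> 'b pair_pre_digraph \<Rightarrow> 'b pair_pre_digraph set" where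
  "copies H G = {S. subgraph (with_proj S) (with_proj G) \<and> digraph_iso (with_proj H) (with_proj S)}"

definition is_decomposition ::
    "nat \<Rightarrow> nat \<Rightarrow> nat \<Rightarrow> (nat \<times> nat) pair_pre_digraph set \<Rightarrow> bool" where
  "is_decomposition l k n X \<longleftrightarrow>
     X \<subseteq> copies (complete_graph k) (complete_multipartite k n) \<and>
     (\<forall>L \<in> copies (complete_graph l) (complete_multipartite k n).
        \<exists>!K. K \<in> X \<and> subgraph (with_proj L) (with_proj K))"

lemma pair_graph_complete_graph: "pair_graph (complete_graph m)"
proof -
  have "finite {(u, v). u \<in> {1..m} \<and> v \<in> {1..m} \<and> u \<noteq> v}"
    by (rule finite_subset[of _ "{1..m} \<times> {1..m}"]) auto
  then show ?thesis
    by unfold_locales (auto simp: complete_graph_def symmetric_def intro!: symI)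
qed

lemma pair_graph_complete_multipartite: "pair_graph (complete_multipartite k n)"
proof -
  have "finite {((c, u), (d, v)). c \<in> {1..k} \<and> d \<in> {1..k} \<and> u \<in> {1..n} \<and> v \<in> {1..n} \<and> c \<noteq> d}"
    by (rule finite_subset[of _ "({1..k} \<times> {1..n}) \<times> ({1..k} \<times> {1..n})"]) auto
  then show ?thesis
    by unfold_locales (auto simp: complete_multipartite_def symmetric_def intro!: symI)
qed

lemma mem_copies_complete_graph_iff:
  "S \<in> copies (complete_graph m) G \<longleftrightarrow>
     subgraph (with_proj S) (with_proj G) \<and> complete_digraph m (with_proj S)"
proof -
  have img: "(\<lambda>e. (h (fst e), h (snd e))) ` parcs (complete_graph m) =
      {(u, v). (u, v) \<in> h ` pverts (complete_graph m) \<times> h ` pverts (complete_graph m) \<and> u \<noteq> v}"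
    if inj: "inj_on h (pverts (complete_graph m))" for h :: "nat \<Rightarrow> 'a"
  proof (intro set_eqI iffI)
    fix e assume "e \<in> (\<lambda>e. (h (fst e), h (snd e))) ` parcs (complete_graph m)"
    then show "e \<in> {(u, v). (u, v) \<in> h ` pverts (complete_graph m) \<times> h ` pverts (complete_graph m) \<and> u \<noteq> v}"
      using inj by (auto simp: complete_graph_def inj_on_eq_iff)
  next
    fix e assume "e \<in> {(u, v). (u, v) \<in> h ` pverts (complete_graph m) \<times> h ` pverts (complete_graph m) \<and> u \<noteq> v}"
    then obtain a b where "e = (h a, h b)" "a \<in> pverts (complete_graph m)"
      "b \<in> pverts (complete_graph m)" "h a \<noteq> h b" by auto
    then show "e \<in> (\<lambda>e. (h (fst e), h (snd e))) ` parcs (complete_graph m)"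
      by (intro image_eqI[of _ _ "(a, b)"]) (auto simp: complete_graph_def)
  qed
  have "complete_digraph m (with_proj S)" if iso: "digraph_iso (with_proj (complete_graph m)) (with_proj S)"
  proof -
    obtain f where f: "pre_digraph.digraph_isomorphism (with_proj (complete_graph m)) f"
      and S: "with_proj S = app_iso f (with_proj (complete_graph m))"
      using iso by (auto simp: digraph_iso_def)
    let ?h = "iso_verts f" and ?C = "complete_graph m"
    have V: "pverts S = ?h ` pverts ?C" and A: "parcs S = iso_arcs f ` parcs ?C"
      and t: "iso_tail f = fst" and h: "iso_head f = snd"
      using S by (simp_all add: with_proj_def app_iso_def)
    have inj: "inj_on ?h (pverts ?C)"
      using f by (simp add: pre_digraph.digraph_isomorphism_def)
    have "iso_arcs f e = (?h (fst e), ?h (snd e))" if "e \<in> parcs ?C" for e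
      using f that t h by (auto simp: pre_digraph.digraph_isomorphism_def prod_eq_iff)
    then have "parcs S = (\<lambda>e. (?h (fst e), ?h (snd e))) ` parcs ?C"
      using A by auto
    also have "\<dots> = {(u, v). (u, v) \<in> pverts S \<times> pverts S \<and> u \<noteq> v}"
      unfolding V by (rule img[OF inj])
    finally show ?thesis
      using V inj unfolding complete_digraph_pair_def
      by (auto simp: card_image complete_graph_def)
  qed
  moreover have "digraph_iso (with_proj (complete_graph m)) (with_proj S)"
    if K: "complete_digraph m (with_proj S)"
  proof -
    have K': "finite (pverts S)" "card (pverts S) = m"
      "parcs S = {(u, v). (u, v) \<in> pverts S \<times> pverts S \<and> u \<noteq> v}"
      using K by (auto simp: complete_digraph_pair_def)
    then obtain h where h: "bij_betw h {1..m} (pverts S)"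
      using ex_bij_betw_nat_finite_1 by metis
    then have inj: "inj_on h {1..m}" and im: "h ` {1..m} = pverts S"
      by (auto simp: bij_betw_def)
    let ?f = "\<lparr>iso_verts = h, iso_arcs = map_prod h h, iso_head = snd, iso_tail = fst\<rparr>"
    have wf: "wf_digraph (with_proj (complete_graph m))"
      unfolding wf_digraph_wp_iff pair_wf_digraph_def by (auto simp: complete_graph_def)
    have "inj_on (map_prod h h) ({1..m} \<times> {1..m})"
      by (rule map_prod_inj_on[OF inj inj])
    then have "inj_on (map_prod h h) (parcs (complete_graph m))"
      by (rule inj_on_subset) (auto simp: complete_graph_def)
    moreover have "inj_on h (pverts (complete_graph m))"
      using inj by (simp add: complete_graph_def)
    ultimately have "pre_digraph.digraph_isomorphism (with_proj (complete_graph m)) ?f"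
      unfolding pre_digraph.digraph_isomorphism_def with_proj_simps using wf by simp
    moreover have "map_prod h h ` parcs (complete_graph m) = parcs S"
      using img[of h] inj unfolding K'(3) im[symmetric]
      by (simp add: complete_graph_def map_prod_def case_prod_unfold)
    then have "with_proj S = app_iso ?f (with_proj (complete_graph m))"
      using im by (simp add: with_proj_def app_iso_def complete_graph_def)
    ultimately show ?thesis by (auto simp: digraph_iso_def)
  qed
  ultimately show ?thesis by (auto simp: copies_def)
qed

end

theory Submission
  imports Defs "HOL-Computational_Algebra.Polynomial" "HOL-Number_Theory.Cong" "HOL-Library.FuncSet"
begin

text \<open>
  The construction is the Reed--Solomon code over the ring \<open>\<int>/n\<close>. A copy of \<open>K\<^sub>k\<close> in \<open>G(k,n)\<close>
  picks one vertex in each colour class, so it is a word \<open>f\<close> of length \<open>k\<close> over \<open>{1..n}\<close>; a copy of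
  \<open>K\<^sub>l\<close> is a partial word, prescribed at \<open>l\<close> positions. An \<open>l\<close>-decomposition is therefore the
  same as a set of words in which every partial word of length \<open>l\<close> has exactly one completion
  (an orthogonal array of strength \<open>l\<close> and index one).

  The words are the value tables at \<open>1, \<dots>, k\<close> of the integer polynomials of degree less than \<open>l\<close>,
  reduced modulo \<open>n\<close>. Completing a partial word is polynomial interpolation. The interpolation
  argument divides only by differences of interpolation points, and two distinct
  points of \<open>{1..k}\<close> differ by a nonzero integer smaller than \<open>k\<close>, all of whose prime factors are
  less than \<open>k\<close> and hence do not divide \<open>n\<close>. So these differences are units modulo \<open>n\<close>, and
  interpolation exists (\<open>interpolation_mod_exists\<close>) and has a unique value table
  (\<open>interpolation_mod_unique\<close>) although \<open>\<int>/n\<close> need not be a field.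
\<close>

section \<open>Polynomial interpolation modulo \<open>n\<close>\<close>

text \<open>
  Newton's scheme: a new point \<open>a\<close> is accommodated by adding a multiple of \<open>\<Prod>t\<in>T. (x - t)\<close>, which
  leaves the values on \<open>T\<close> alone and takes a unit value at \<open>a\<close>.
\<close>

lemma interpolation_mod_exists:
  fixes T :: "int set" and g :: "int \<Rightarrow> int"
  assumes "finite T" and "T \<noteq> {}"
    and "\<And>s t. s \<in> T \<Longrightarrow> t \<in> T \<Longrightarrow> s \<noteq> t \<Longrightarrow> coprime (s - t) n"
  shows "\<exists>p. degree p < card T \<and> (\<forall>t\<in>T. [poly p t = g t] (mod n))"
  using assms
proof (induction T rule: finite_ne_induct)
  case (singleton a)
  show ?case by (rule exI[of _ "[:g a:]"]) simp
next
  case (insert a T)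
  then obtain p where p: "degree p < card T" "\<And>t. t \<in> T \<Longrightarrow> [poly p t = g t] (mod n)"
    using insert.IH insert.prems by auto
  define w where "w = (\<Prod>t\<in>T. [:-t, 1:])"
  have "coprime (poly w a) n"
    unfolding w_def poly_prod
    using insert.prems insert.hyps by (intro prod_coprime_left) (auto simp: coprime_commute)
  then obtain u where u: "[poly w a * u = 1] (mod n)"
    using cong_solve_coprime_int by blast
  define q where "q = p + smult (u * (g a - poly p a)) w"
  have "degree w \<le> card T"
    unfolding w_def using degree_prod_sum_le[OF insert.hyps(1), of "\<lambda>t. [:-t, 1:]"] by simp
  then have "degree q \<le> card T"
    unfolding q_def using p(1) by (intro degree_add_le) (auto intro: order_trans[OF degree_smult_le])
  moreover have "[poly q t = g t] (mod n)" if "t \<in> T" for t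
  proof -
    have "poly w t = 0"
      unfolding w_def poly_prod using that insert.hyps(1) by (intro prod_zero) auto
    then show ?thesis using p(2)[OF that] by (simp add: q_def)
  qed
  moreover have "[poly q a = g a] (mod n)"
  proof -
    have "[poly p a + (poly w a * u) * (g a - poly p a) = poly p a + 1 * (g a - poly p a)] (mod n)"
      using u by (intro cong_add cong_mult cong_refl)
    then show ?thesis by (simp add: q_def algebra_simps)
  qed
  ultimately show ?case
    using insert.hyps by (intro exI[of _ q]) auto
qed

text \<open>
  As over a field: writing \<open>p = (x - a) q + p(a)\<close>, the quotient \<open>q\<close> vanishes modulo \<open>n\<close> at all other
  zeros of \<open>p\<close>, because \<open>t - a\<close> can be cancelled there.
\<close>

lemma poly_zero_mod_if_many_zeros:
  fixes T :: "int set" and p :: "int poly"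
  assumes "finite T" and "degree p < card T"
    and "\<And>s t. s \<in> T \<Longrightarrow> t \<in> T \<Longrightarrow> s \<noteq> t \<Longrightarrow> coprime (s - t) n"
    and "\<And>t. t \<in> T \<Longrightarrow> [poly p t = 0] (mod n)"
  shows "[poly p x = 0] (mod n)"
  using assms
proof (induction T arbitrary: p x rule: finite_induct)
  case empty
  then show ?case by simp
next
  case (insert a T)
  define q where "q = synthetic_div p a"
  have p_eq: "poly p t = (t - a) * poly q t + poly p a" for t
  proof -
    have "poly (p + smult a q) t = poly (pCons (poly p a) q) t"
      using synthetic_div_correct[of p a] by (simp add: q_def)
    then show ?thesis by (simp add: algebra_simps)
  qed
  have pa: "[poly p a = 0] (mod n)"
    using insert.prems by simp
  have "[poly q x = 0] (mod n)"
  proof (cases "degree p = 0")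
    case True
    then have "q = 0" by (simp add: q_def synthetic_div_eq_0_iff)
    then show ?thesis by simp
  next
    case False
    show ?thesis
    proof (rule insert.IH)
      show "degree q < card T"
        using insert.prems(1) insert.hyps False by (simp add: q_def degree_synthetic_div)
      show "coprime (s - t) n" if "s \<in> T" "t \<in> T" "s \<noteq> t" for s t
        using insert.prems(2) that by blast
      show "[poly q t = 0] (mod n)" if "t \<in> T" for t
      proof -
        have "coprime (t - a) n" using insert.prems(2)[of t a] insert.hyps that by auto
        moreover have "n dvd (t - a) * poly q t"
          using insert.prems(3)[of t] pa p_eq[of t] that
          by (simp add: cong_0_iff dvd_add_left_iff)
        ultimately show ?thesis by (metis cong_0_iff coprime_dvd_mult_right_iff coprime_commute)
      qed
    qed
  qed
  then show ?case
    using pa by (simp add: p_eq[of x] cong_0_iff)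
qed

corollary interpolation_mod_unique:
  fixes T :: "int set" and p q :: "int poly"
  assumes "finite T" and "degree p < card T" and "degree q < card T"
    and "\<And>s t. s \<in> T \<Longrightarrow> t \<in> T \<Longrightarrow> s \<noteq> t \<Longrightarrow> coprime (s - t) n"
    and "\<And>t. t \<in> T \<Longrightarrow> [poly p t = poly q t] (mod n)"
  shows "[poly p x = poly q x] (mod n)"
proof -
  have "[poly (p - q) x = 0] (mod n)"
  proof (rule poly_zero_mod_if_many_zeros[OF assms(1) _ assms(4)])
    show "degree (p - q) < card T"
      using assms(2,3) by (rule degree_diff_less)
    show "[poly (p - q) t = 0] (mod n)" if "t \<in> T" for t
      using assms(5)[OF that] by (simp add: cong_0_iff cong_iff_dvd_diff)
  qed
  then show ?thesis by (simp add: cong_0_iff cong_iff_dvd_diff)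
qed

section \<open>Orthogonal arrays of index one\<close>

definition orthogonal_array :: "nat \<Rightarrow> nat \<Rightarrow> nat \<Rightarrow> (nat \<Rightarrow> nat) set \<Rightarrow> bool" where
  "orthogonal_array l k n C \<longleftrightarrow>
     C \<subseteq> {1..k} \<rightarrow>\<^sub>E {1..n} \<and>
     (\<forall>T g. T \<subseteq> {1..k} \<and> card T = l \<and> g \<in> T \<rightarrow> {1..n} \<longrightarrow>
        (\<exists>!f. f \<in> C \<and> (\<forall>c\<in>T. f c = g c)))"

lemma coprime_diff_if_no_small_prime_divisor:
  fixes k n a b :: nat
  assumes "\<forall>p. prime p \<and> p < k \<longrightarrow> \<not> p dvd n"
    and "a \<in> {1..k}" and "b \<in> {1..k}" and "a \<noteq> b"
  shows "coprime (int a - int b) (int n)"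
proof (rule ccontr)
  assume "\<not> coprime (int a - int b) (int n)"
  then have "\<not> coprime (nat \<bar>int a - int b\<bar>) n"
    by (metis coprime_abs_left_iff coprime_int_iff int_nat_eq abs_ge_zero)
  then have "gcd (nat \<bar>int a - int b\<bar>) n \<noteq> 1"
    using coprime_iff_gcd_eq_1 by blast
  then obtain p where "prime p" "p dvd gcd (nat \<bar>int a - int b\<bar>) n"
    using prime_factor_nat by blast
  then have p: "prime p" "p dvd nat \<bar>int a - int b\<bar>" "p dvd n"
    unfolding gcd_greatest_iff by blast+
  have "p \<le> nat \<bar>int a - int b\<bar>"
    using p(2) assms(4) by (intro dvd_imp_le) auto
  also have "\<dots> < k" using assms(2-4) by auto
  finally show False using assms(1) p by blast
qed

text \<open>
  Residues run through \<open>{0..<n}\<close> but the vertices of a colour class are \<open>{1..n}\<close>, hence the shift by one.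
\<close>

definition value_table :: "nat \<Rightarrow> nat \<Rightarrow> int poly \<Rightarrow> nat \<Rightarrow> nat" where
  "value_table k n p = (\<lambda>c\<in>{1..k}. Suc (nat (poly p (int c) mod int n)))"

lemma value_table_in_range:
  assumes "0 < n"
  shows "value_table k n p \<in> {1..k} \<rightarrow>\<^sub>E {1..n}"
  using assms by (auto simp: value_table_def Suc_le_eq nat_less_iff)

lemma value_table_eq_iff:
  assumes "0 < n" and "c \<in> {1..k}" and "v \<in> {1..n}"
  shows "value_table k n p c = v \<longleftrightarrow> [poly p (int c) = int v - 1] (mod int n)"
proof -
  have "value_table k n p c = v \<longleftrightarrow> poly p (int c) mod int n = int v - 1"
    using assms by (auto simp: value_table_def)
  also have "int v - 1 = (int v - 1) mod int n"
    using assms by simp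
  finally show ?thesis by (simp add: cong_def)
qed

lemma value_table_cong_iff:
  assumes "0 < n" and "c \<in> {1..k}"
  shows "value_table k n p c = value_table k n q c \<longleftrightarrow>
    [poly p (int c) = poly q (int c)] (mod int n)"
  using assms by (auto simp: value_table_def cong_def nat_eq_iff)

theorem orthogonal_array_polynomials:
  assumes "0 < n" and "0 < l"
    and "\<forall>p. prime p \<and> p < k \<longrightarrow> \<not> p dvd n"
  shows "orthogonal_array l k n (value_table k n ` {p. degree p < l})"
  unfolding orthogonal_array_def
proof (intro conjI allI impI)
  show "value_table k n ` {p. degree p < l} \<subseteq> {1..k} \<rightarrow>\<^sub>E {1..n}"
    using value_table_in_range[OF assms(1)] by blast
next
  fix T g assume Tg: "T \<subseteq> {1..k} \<and> card T = l \<and> g \<in> T \<rightarrow> {1..n}"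
  have card: "card (int ` T) = l"
    using Tg by (simp add: card_image)
  have fin: "finite (int ` T)" and ne: "int ` T \<noteq> {}"
    using Tg finite_subset assms(2) by auto
  have unit: "coprime (s - t) (int n)" if "s \<in> int ` T" "t \<in> int ` T" "s \<noteq> t" for s t
    using coprime_diff_if_no_small_prime_divisor[OF assms(3)] Tg that by blast
  obtain p where p: "degree p < l"
    "\<And>c. c \<in> T \<Longrightarrow> [poly p (int c) = int (g c) - 1] (mod int n)"
    using interpolation_mod_exists[OF fin ne unit, of "\<lambda>x. int (g (nat x)) - 1"] card by auto
  show "\<exists>!f. f \<in> value_table k n ` {p. degree p < l} \<and> (\<forall>c\<in>T. f c = g c)"
  proof (rule ex1I[of _ "value_table k n p"])
    have "value_table k n p c = g c" if "c \<in> T" for c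
      using value_table_eq_iff[OF assms(1), of c k "g c" p] p(2) Tg that by blast
    then show pg: "value_table k n p \<in> value_table k n ` {p. degree p < l} \<and>
      (\<forall>c\<in>T. value_table k n p c = g c)"
      using p(1) by blast
    fix f assume f: "f \<in> value_table k n ` {p. degree p < l} \<and> (\<forall>c\<in>T. f c = g c)"
    then obtain q where q: "degree q < l" "f = value_table k n q" by blast
    have "[poly q t = poly p t] (mod int n)" if t: "t \<in> int ` T" for t
    proof -
      obtain c where c: "t = int c" "c \<in> T" using t by blast
      then have "value_table k n q c = value_table k n p c" using f pg q(2) by simp
      then show ?thesis using value_table_cong_iff[OF assms(1), of c k] c Tg by blast
    qed
    then have "[poly q x = poly p x] (mod int n)" for x
      using interpolation_mod_unique[OF fin _ _ unit] p(1) q(1) card by simp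
    then show "f = value_table k n p"
      using q(2) by (auto simp: value_table_def cong_def)
  qed
qed

section \<open>Cliques of the complete multipartite graph\<close>

definition clique_on :: "'a set \<Rightarrow> 'a pair_pre_digraph" where
  "clique_on W = \<lparr>pverts = W, parcs = {(u, v). u \<in> W \<and> v \<in> W \<and> u \<noteq> v}\<rparr>"

lemma subgraph_clique_on_iff:
  "subgraph (with_proj (clique_on V)) (with_proj (clique_on W)) \<longleftrightarrow> V \<subseteq> W"
proof -
  have "wf_digraph (with_proj (clique_on U))" for U :: "'a set"
    unfolding wf_digraph_wp_iff pair_wf_digraph_def by (auto simp: clique_on_def)
  then show ?thesis
    by (auto simp: subgraph_def compatible_def clique_on_def)
qed

text \<open>
  A clique meets each colour class at most once, which is what makes it the graph of a partial word.
\<close>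

lemma copies_in_complete_multipartite_iff:
  "S \<in> copies (complete_graph m) (complete_multipartite k n) \<longleftrightarrow>
    (\<exists>W. S = clique_on W \<and> W \<subseteq> {1..k} \<times> {1..n} \<and> card W = m \<and> inj_on fst W)"
proof
  assume "S \<in> copies (complete_graph m) (complete_multipartite k n)"
  then have sub: "subgraph (with_proj S) (with_proj (complete_multipartite k n))"
    and compl: "complete_digraph m (with_proj S)"
    by (auto simp: mem_copies_complete_graph_iff)
  have arcs: "parcs S = {(u, v). u \<in> pverts S \<and> v \<in> pverts S \<and> u \<noteq> v}"
    and card: "card (pverts S) = m"
    using compl by (auto simp: complete_digraph_pair_def)
  have "pverts S \<subseteq> {1..k} \<times> {1..n}" and "parcs S \<subseteq> parcs (complete_multipartite k n)"
    using sub by (auto simp: subgraph_def complete_multipartite_def)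
  moreover from this(2) have "inj_on fst (pverts S)"
    unfolding arcs by (fastforce simp: complete_multipartite_def intro!: inj_onI)
  moreover have "S = clique_on (pverts S)"
    using arcs by (simp add: clique_on_def)
  ultimately show "\<exists>W. S = clique_on W \<and> W \<subseteq> {1..k} \<times> {1..n} \<and> card W = m \<and> inj_on fst W"
    using card by blast
next
  assume "\<exists>W. S = clique_on W \<and> W \<subseteq> {1..k} \<times> {1..n} \<and> card W = m \<and> inj_on fst W"
  then obtain W where W: "S = clique_on W" "W \<subseteq> {1..k} \<times> {1..n}" "card W = m" "inj_on fst W"
    by blast
  have "finite W" using W(2) finite_subset by blast
  then have "complete_digraph m (with_proj S)"
    using W by (auto simp: complete_digraph_pair_def clique_on_def)
  moreover have "wf_digraph (with_proj S)"
    unfolding wf_digraph_wp_iff pair_wf_digraph_def using W(1) by (auto simp: clique_on_def)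
  moreover have "wf_digraph (with_proj (complete_multipartite k n))"
    unfolding wf_digraph_wp_iff pair_wf_digraph_def by (auto simp: complete_multipartite_def)
  moreover have "parcs S \<subseteq> parcs (complete_multipartite k n)"
    using W by (fastforce simp: clique_on_def complete_multipartite_def inj_on_def)
  ultimately show "S \<in> copies (complete_graph m) (complete_multipartite k n)"
    using W(1,2)
    by (auto simp: mem_copies_complete_graph_iff subgraph_def compatible_def
        clique_on_def complete_multipartite_def)
qed

definition word_graph :: "nat set \<Rightarrow> (nat \<Rightarrow> nat) \<Rightarrow> (nat \<times> nat) set" where
  "word_graph T f = (\<lambda>c. (c, f c)) ` T"

lemma copies_eq_partial_words:
  "S \<in> copies (complete_graph m) (complete_multipartite k n) \<longleftrightarrow>
    (\<exists>T g. S = clique_on (word_graph T g) \<and> T \<subseteq> {1..k} \<and> card T = m \<and> g \<in> T \<rightarrow> {1..n})"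
proof
  assume "S \<in> copies (complete_graph m) (complete_multipartite k n)"
  then obtain W where W: "S = clique_on W" "W \<subseteq> {1..k} \<times> {1..n}" "card W = m" "inj_on fst W"
    by (auto simp: copies_in_complete_multipartite_iff)
  define g where "g = (\<lambda>c. snd (inv_into W fst c))"
  have g: "g (fst w) = snd w" if "w \<in> W" for w
    using W(4) that by (simp add: g_def)
  have "W = word_graph (fst ` W) g"
    unfolding word_graph_def image_image using g by simp
  moreover have "fst ` W \<subseteq> {1..k}" using W(2) by auto
  moreover have "g \<in> fst ` W \<rightarrow> {1..n}" using W(2) g by fastforce
  moreover have "card (fst ` W) = m" using W(3,4) by (simp add: card_image)
  ultimately show "\<exists>T g. S = clique_on (word_graph T g) \<and> T \<subseteq> {1..k} \<and> card T = m \<and> g \<in> T \<rightarrow> {1..n}"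
    using W(1) by metis
next
  assume "\<exists>T g. S = clique_on (word_graph T g) \<and> T \<subseteq> {1..k} \<and> card T = m \<and> g \<in> T \<rightarrow> {1..n}"
  then obtain T g where S: "S = clique_on (word_graph T g)"
    and T: "T \<subseteq> {1..k}" "card T = m" "g \<in> T \<rightarrow> {1..n}" by blast
  have "card (word_graph T g) = m"
    unfolding word_graph_def using T(2) by (simp add: card_image inj_on_def)
  then show "S \<in> copies (complete_graph m) (complete_multipartite k n)"
    unfolding copies_in_complete_multipartite_iff using S T
    by (intro exI[of _ "word_graph T g"]) (auto simp: word_graph_def inj_on_def)
qed

theorem decomposition_of_orthogonal_array:
  assumes "orthogonal_array l k n C"
  shows "is_decomposition l k n ((\<lambda>f. clique_on (word_graph {1..k} f)) ` C)"
  unfolding is_decomposition_def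
proof (intro conjI ballI)
  show "(\<lambda>f. clique_on (word_graph {1..k} f)) ` C
      \<subseteq> copies (complete_graph k) (complete_multipartite k n)"
  proof (rule image_subsetI)
    fix f assume "f \<in> C"
    then have "f \<in> {1..k} \<rightarrow> {1..n}"
      using assms by (auto simp: orthogonal_array_def)
    then show "clique_on (word_graph {1..k} f) \<in> copies (complete_graph k) (complete_multipartite k n)"
      unfolding copies_eq_partial_words by (intro exI[of _ "{1..k}"] exI[of _ f]) simp
  qed
next
  fix L assume "L \<in> copies (complete_graph l) (complete_multipartite k n)"
  then obtain T g where L: "L = clique_on (word_graph T g)"
    and T: "T \<subseteq> {1..k}" "card T = l" "g \<in> T \<rightarrow> {1..n}"
    unfolding copies_eq_partial_words by blast
  have sub: "subgraph (with_proj L) (with_proj (clique_on (word_graph {1..k} f))) \<longleftrightarrow>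
      (\<forall>c\<in>T. f c = g c)" for f
    unfolding L subgraph_clique_on_iff using T(1) by (auto simp: word_graph_def)
  have "\<exists>!f. f \<in> C \<and> (\<forall>c\<in>T. f c = g c)"
    using assms T unfolding orthogonal_array_def by blast
  then show "\<exists>!K. K \<in> (\<lambda>f. clique_on (word_graph {1..k} f)) ` C \<and>
      subgraph (with_proj L) (with_proj K)"
    using sub by (smt (verit, best) imageE imageI)
qed

section \<open>Existence of decompositions\<close>

theorem theorem10:
  fixes n k l :: nat
  assumes "k \<le> n" and "l \<le> k" and "2 \<le> l"
    and "\<forall>p. prime p \<and> p < k \<longrightarrow> \<not> p dvd n"
  shows "\<exists>X. is_decomposition l k n X"
proof -
  have "orthogonal_array l k n (value_table k n ` {p. degree p < l})"
    using assms by (intro orthogonal_array_polynomials) auto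
  then show ?thesis
    using decomposition_of_orthogonal_array by blast
qed

end
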